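(* Let $n\ge1$, let $A\in\mathbb{H}^{n\times n}$ and $B\in\mathbb{H}^n$ be such that the pair $(A,B)$ is controllable, and let $a(\lambda)\in\mathbb{H}[\lambda]$ be the companion polynomial of $(A,B)$. Then: 1. If $\lambda\in\mathbb{H}$ is a right zero of $a$, then $\lambda$ is a right eigenvalue of $A$. 2. Consequently, $\sigma_r(A)=\{[\lambda]:\lambda\in\mathbb{H},\ a(\lambda)_r=0\}$. 3. Every left zero $\mu\in\mathbb{H}$ of $a$ is a right eigenvalue of $A$.
   Context: $\mathbb{H}$ denotes the real quaternions (noncommutative). Two quaternions $q,r$ are similar if $q=\alpha^{-1}r\alpha$ for some nonzero $\alpha\in\mathbb{H}$; $[q]$ denotes the similarity class of $q$. In $\mathbb{H}[\lambda]$ the indeterminate commutes with the coefficients. For $p(\lambda)=\sum_k p_k\lambda^k\in\mathbb{H}[\lambda]$ and $q\in\mathbb{H}$, $p(q)_r=\sum_k p_kq^k$ and $p(q)_\ell=\sum_k q^kp_k$. A right zero of $p$ is $q$ with $p(q)_r=0$; a left zero is $q$ with $p(q)_\ell=0$. For $M\in\mathbb{H}^{n\times n}$, $\lambda\in\mathbb{H}$ is a right eigenvalue of $M$ if $Mv=v\lambda$ for some nonzero $v\in\mathbb{H}^n$; the right spectrum is $\sigma_r(M)=\{[\lambda]:\exists\, v\neq0,\ Mv=v\lambda\}$. $(A,B)$ is controllable if the controllability matrix $\mathcal{C}=[B,AB,\dots,A^{n-1}B]$ is invertible over $\mathbb{H}$. In that case there is a unique invertible $T\in\mathbb{H}^{n\times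 n}$ such that $A_c=T^{-1}AT$, $B_c=T^{-1}B$ is in lower controllable companion form, meaning $$A_c=\begin{bmatrix}0&1&\cdots&0\\ \vdots&\vdots&\ddots&\vdots\\ 0&0&\cdots&1\\ -a_0&-a_1&\cdots&-a_{n-1}\end{bmatrix},\qquad B_c=\begin{bmatrix}0\\ \vdots\\ 0\\ 1\end{bmatrix}$$ for some $a_0,\dots,a_{n-1}\in\mathbb{H}$ (explicitly, $T^{-1}$ has rows $t,tA,\dots,tA^{n-1}$, where $t$ is the last row of $\mathcal{C}^{-1}$). The companion polynomial of $(A,B)$ is $a(\lambda)=a_0+a_1\lambda+\cdots+a_{n-1}\lambda^{n-1}+\lambda^n$, with the $a_i$ read off from the last row of this $A_c$. *)

theory Defs
  imports Complex_Main "HOL-Computational_Algebra.Polynomial" "Jordan_Normal_Form.Matrix"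
begin

section \<open>The real quaternions\<close>

datatype quat = Quat (qre: real) (qi: real) (qj: real) (qk: real)

instantiation quat :: division_ring
begin

definition zero_quat :: quat where
  "0 = Quat 0 0 0 0"

definition one_quat :: quat where
  "1 = Quat 1 0 0 0"

definition uminus_quat :: "quat \<Rightarrow> quat" where
  "- q = Quat (- qre q) (- qi q) (- qj q) (- qk q)"

definition plus_quat :: "quat \<Rightarrow> quat \<Rightarrow> quat" where
  "q + r = Quat (qre q + qre r) (qi q + qi r) (qj q + qj r) (qk q + qk r)"

definition minus_quat :: "quat \<Rightarrow> quat \<Rightarrow> quat" where
  "q - r = Quat (qre q - qre r) (qi q - qi r) (qj q - qj r) (qk q - qk r)"

text \<open>Hamilton's product: \<open>i\<^sup>2 = j\<^sup>2 = k\<^sup>2 = ijk = -1\<close>.\<close>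

definition times_quat :: "quat \<Rightarrow> quat \<Rightarrow> quat" where
  "q * r = Quat
     (qre q * qre r - qi q * qi r - qj q * qj r - qk q * qk r)
     (qre q * qi r + qi q * qre r + qj q * qk r - qk q * qj r)
     (qre q * qj r - qi q * qk r + qj q * qre r + qk q * qi r)
     (qre q * qk r + qi q * qj r - qj q * qi r + qk q * qre r)"

text \<open>The conjugate divided by the squared norm; this yields \<open>inverse 0 = 0\<close>.\<close>

definition inverse_quat :: "quat \<Rightarrow> quat" where
  "inverse q = (let s = (qre q)\<^sup>2 + (qi q)\<^sup>2 + (qj q)\<^sup>2 + (qk q)\<^sup>2
     in Quat (qre q / s) (- qi q / s) (- qj q / s) (- qk q / s))"

definition divide_quat :: "quat \<Rightarrow> quat \<Rightarrow> quat" where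
  "divide_quat q r = q * inverse r"

lemma quat_norm_sq_nonzero:
  assumes "q \<noteq> (0::quat)"
  shows "(qre q)\<^sup>2 + (qi q)\<^sup>2 + (qj q)\<^sup>2 + (qk q)\<^sup>2 \<noteq> 0"
  using assms
  by (cases q) (auto simp: zero_quat_def add_nonneg_eq_0_iff)

instance
proof
  fix a b c :: quat
  show "a * b * c = a * (b * c)"
    by (simp add: times_quat_def algebra_simps)
  show "(a + b) * c = a * c + b * c" "a * (b + c) = a * b + a * c"
    by (simp_all add: times_quat_def plus_quat_def algebra_simps)
  show "1 * a = a" "a * 1 = a"
    by (simp_all add: times_quat_def one_quat_def)
  show "a + b + c = a + (b + c)" "a + b = b + a"
    by (simp_all add: plus_quat_def)
  show "0 + a = a" "- a + a = 0" "a - b = a + - b"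
    by (simp_all add: plus_quat_def zero_quat_def uminus_quat_def minus_quat_def)
  show "(0::quat) \<noteq> 1"
    by (simp add: zero_quat_def one_quat_def)
  show "inverse (0::quat) = 0"
    by (simp add: inverse_quat_def zero_quat_def)
  show "a div b = a * inverse b"
    by (rule divide_quat_def)
  assume "a \<noteq> 0"
  then have nz: "(qre a)\<^sup>2 + (qi a)\<^sup>2 + (qj a)\<^sup>2 + (qk a)\<^sup>2 \<noteq> 0"
    by (rule quat_norm_sq_nonzero)
  show "inverse a * a = 1" "a * inverse a = 1"
    using nz unfolding times_quat_def inverse_quat_def one_quat_def Let_def
    by (simp_all add: divide_simps) (simp_all add: power2_eq_square algebra_simps)
qed

end

definition quat_similar :: "quat \<Rightarrow> quat \<Rightarrow> bool" where
  "quat_similar q r \<longleftrightarrow> (\<exists>\<alpha>. \<alpha> \<noteq> 0 \<and> q = inverse \<alpha> * r * \<alpha>)"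

definition similarity_class :: "quat \<Rightarrow> quat set" where
  "similarity_class q = {r. quat_similar r q}"

section \<open>Quaternionic polynomials\<close>

text \<open>
  The library evaluation function \<open>poly\<close> needs commutative coefficients, so the two
  one-sided evaluations are defined from the coefficients.
\<close>

definition eval_right :: "quat poly \<Rightarrow> quat \<Rightarrow> quat" where
  "eval_right p q = (\<Sum>k\<le>degree p. coeff p k * q ^ k)"

definition eval_left :: "quat poly \<Rightarrow> quat \<Rightarrow> quat" where
  "eval_left p q = (\<Sum>k\<le>degree p. q ^ k * coeff p k)"

definition right_zero :: "quat poly \<Rightarrow> quat \<Rightarrow> bool" where
  "right_zero p q \<longleftrightarrow> eval_right p q = 0"

definition left_zero :: "quat poly \<Rightarrow> quat \<Rightarrow> bool" where
  "left_zero p q \<longleftrightarrow> eval_left p q = 0"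

section \<open>Right eigenvalues\<close>

text \<open>
  The library scaling \<open>c \<cdot>\<^sub>v v\<close> multiplies by the scalar on the left; here it has to stand
  on the right.
\<close>

definition right_eigenvalue :: "quat mat \<Rightarrow> quat \<Rightarrow> bool" where
  "right_eigenvalue M l \<longleftrightarrow>
     (\<exists>v \<in> carrier_vec (dim_row M). v \<noteq> 0\<^sub>v (dim_row M) \<and> M *\<^sub>v v = map_vec (\<lambda>x. x * l) v)"

definition right_spectrum :: "quat mat \<Rightarrow> quat set set" where
  "right_spectrum M = {similarity_class l | l. right_eigenvalue M l}"

section \<open>Controllability and the companion polynomial\<close>

definition mat_inv :: "quat mat \<Rightarrow> quat mat" where
  "mat_inv M = (THE N. inverts_mat M N \<and> inverts_mat N M)"

definition controllability_mat :: "quat mat \<Rightarrow> quat vec \<Rightarrow> quat mat" where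
  "controllability_mat A B =
     mat_of_cols (dim_row A) (map (\<lambda>k. (A ^\<^sub>m k) *\<^sub>v B) [0..<dim_row A])"

definition controllable :: "quat mat \<Rightarrow> quat vec \<Rightarrow> bool" where
  "controllable A B \<longleftrightarrow> invertible_mat (controllability_mat A B)"

definition lower_companion_mat :: "nat \<Rightarrow> (nat \<Rightarrow> quat) \<Rightarrow> quat mat" where
  "lower_companion_mat n a =
     mat n n (\<lambda>(i, j). if i = n - 1 then - a j else if j = i + 1 then 1 else 0)"

definition lower_companion_form :: "nat \<Rightarrow> quat mat \<Rightarrow> quat vec \<Rightarrow> bool" where
  "lower_companion_form n Ac Bc \<longleftrightarrow>
     (\<exists>a. Ac = lower_companion_mat n a) \<and> Bc = unit_vec n (n - 1)"

text \<open>For a controllable pair the transformation below exists and is unique.\<close>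

definition companion_transform :: "quat mat \<Rightarrow> quat vec \<Rightarrow> quat mat" where
  "companion_transform A B =
     (THE T. T \<in> carrier_mat (dim_row A) (dim_row A) \<and> invertible_mat T \<and>
        lower_companion_form (dim_row A) (mat_inv T * A * T) (mat_inv T *\<^sub>v B))"

definition companion_poly :: "quat mat \<Rightarrow> quat vec \<Rightarrow> quat poly" where
  "companion_poly A B =
     (let n = dim_row A; T = companion_transform A B; Ac = mat_inv T * A * T
      in (\<Sum>i<n. monom (- (Ac $$ (n - 1, i))) i) + monom 1 n)"

end

theory Submission
  imports Defs "HOL-Computational_Algebra.Formal_Power_Series"
begin

text \<open>Writing \<open>\<C>\<close> for the controllability matrix, the companion transformation is \<open>\<C> H\<close> with
  \<open>H\<close> the Hankel matrix of the unique monic \<open>a\<close> with \<open>\<Sum> A\<^sup>k B a\<^sub>k = 0\<close>. An eigenvector \<open>v\<close> of the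
  companion matrix for \<open>l\<close> has entries \<open>v\<^sub>0 l\<^sup>i\<close> with \<open>v\<^sub>0 \<noteq> 0\<close>, and the last row says that
  \<open>v\<^sub>0 l v\<^sub>0\<^sup>-\<^sup>1\<close> is a right zero of \<open>a\<close>; so the eigenvalues are the quaternions similar to right zeros.
  Every left zero is similar to a right zero.\<close>

section \<open>Similar quaternions\<close>

lemma quat_power_conj:
  fixes h m :: quat
  assumes "h \<noteq> 0"
  shows "(inverse h * m * h) ^ k = inverse h * m ^ k * h"
proof (induction k)
  case 0
  then show ?case using assms by simp
next
  case (Suc k)
  have "(inverse h * m * h) ^ Suc k = inverse h * m * (h * inverse h) * m ^ k * h"
    unfolding power_Suc Suc by (simp only: mult.assoc)
  then show ?case using assms by (simp add: mult.assoc)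
qed

text \<open>Every quaternion satisfies \<open>m * m = t * m - s\<close> with \<open>t\<close> twice
  its real part and \<open>s\<close> its squared norm, so powers reduce to degree one. That the
  coefficients are real is recorded as commuting with everything, the form in which it is
  used.\<close>

lemma quat_power_quadratic:
  fixes m :: quat
  shows "\<exists>x y. (\<forall>c. x * c = c * x) \<and> (\<forall>c. y * c = c * y) \<and> m ^ k = x * m + y"
proof (induction k)
  case 0
  have "m ^ 0 = 0 * m + 1" by simp
  then show ?case by (intro exI[of _ 0] exI[of _ 1]) simp
next
  case (Suc k)
  then obtain x y where x: "\<And>c. x * c = c * x" and y: "\<And>c. y * c = c * y"
    and k: "m ^ k = x * m + y" by blast
  define t where "t = Quat (2 * qre m) 0 0 0"
  define s where "s = Quat ((qre m)\<^sup>2 + (qi m)\<^sup>2 + (qj m)\<^sup>2 + (qk m)\<^sup>2) 0 0 0"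
  have t: "t * c = c * t" and s: "s * c = c * s" for c
    by (simp_all add: t_def s_def times_quat_def)
  have sq: "m * m = t * m - s"
    by (simp add: t_def s_def times_quat_def minus_quat_def power2_eq_square)
  have "m ^ Suc k = x * (m * m) + y * m"
    unfolding power_Suc2 k by (simp add: distrib_right mult.assoc)
  also have "\<dots> = (x * t + y) * m + (- (x * s))"
    unfolding sq by (simp add: algebra_simps)
  finally have "m ^ Suc k = (x * t + y) * m + (- (x * s))" .
  moreover have "(x * t + y) * c = c * (x * t + y)" for c
    by (metis x y t distrib_left distrib_right mult.assoc)
  moreover have "- (x * s) * c = c * - (x * s)" for c
    by (metis x s minus_mult_left minus_mult_right mult.assoc)
  ultimately show ?case by blast
qed

lemma quat_similar_refl: "quat_similar q q"
  unfolding quat_similar_def by (intro exI[of _ 1]) simp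

lemma quat_similar_sym: "quat_similar q r \<Longrightarrow> quat_similar r q"
proof -
  assume "quat_similar q r"
  then obtain h where h: "h \<noteq> 0" "q = inverse h * r * h" unfolding quat_similar_def by blast
  then have "r = inverse (inverse h) * q * inverse h"
    by (simp add: mult.assoc) (simp flip: mult.assoc)
  then show ?thesis using h unfolding quat_similar_def by (metis nonzero_imp_inverse_nonzero)
qed

lemma quat_similar_trans: "quat_similar q r \<Longrightarrow> quat_similar r s \<Longrightarrow> quat_similar q s"
proof -
  assume "quat_similar q r" "quat_similar r s"
  then obtain h g where h: "h \<noteq> 0" "q = inverse h * r * h" and g: "g \<noteq> 0" "r = inverse g * s * g"
    unfolding quat_similar_def by blast
  then have "q = inverse (g * h) * s * (g * h)"
    by (simp add: nonzero_inverse_mult_distrib mult.assoc)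
  then show ?thesis using h g unfolding quat_similar_def by (metis no_zero_divisors)
qed

lemma similarity_class_eqI: "quat_similar q r \<Longrightarrow> similarity_class q = similarity_class r"
  unfolding similarity_class_def using quat_similar_sym quat_similar_trans by blast

text \<open>Modulo the real quadratic polynomial vanishing on the class of \<open>m\<close>, \<open>p\<close> is
  \<open>A\<^sub>1 \<lambda> + A\<^sub>0\<close>. A left zero gives \<open>A\<^sub>0 = - m A\<^sub>1\<close>, so \<open>A\<^sub>1\<^sup>-\<^sup>1 m A\<^sub>1\<close> is a right zero.\<close>

lemma left_zero_imp_similar_right_zero:
  assumes "left_zero p m"
  obtains q where "right_zero p q" "quat_similar q m"
proof -
  obtain x y where x: "\<And>k c. x k * c = c * x k" and y: "\<And>k c. y k * c = c * y k"
    and pow: "\<And>k. m ^ k = x k * m + y k"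
    using quat_power_quadratic[of m] by metis
  define A1 where "A1 = (\<Sum>k\<le>degree p. coeff p k * x k)"
  define A0 where "A0 = (\<Sum>k\<le>degree p. coeff p k * y k)"
  \<comment> \<open>The central \<open>x k\<close> and \<open>y k\<close> move past
    \<open>c\<close>, leaving \<open>m\<close> alone on the left; left evaluation at
    \<open>m\<close> thus becomes \<open>m * A1 + A0\<close>.\<close>
  have left: "m ^ k * c = m * (c * x k) + c * y k" for k c
    by (metis pow x y distrib_right mult.assoc)
  have A0: "m * A1 + A0 = 0"
    using assms unfolding left_zero_def eval_left_def A1_def A0_def left
    by (simp add: sum.distrib sum_distrib_left)
  have right: "eval_right p (inverse h * m * h) = A1 * (inverse h * m * h) + A0" if "h \<noteq> 0" for h
  proof -
    \<comment> \<open>Conjugation fixes the central coefficients, so all conjugates of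
      \<open>m\<close> share one linear expression for their powers.\<close>
    have "(inverse h * m * h) ^ k = x k * (inverse h * m * h) + y k" for k
    proof -
      have "(inverse h * m * h) ^ k = inverse h * (x k * m) * h + inverse h * y k * h"
        unfolding quat_power_conj[OF that] pow by (simp add: algebra_simps)
      also have "inverse h * y k * h = y k"
        by (metis y mult.assoc left_inverse that mult_1_right)
      also have "inverse h * (x k * m) * h = x k * (inverse h * m * h)"
        by (metis x mult.assoc)
      finally show ?thesis .
    qed
    then show ?thesis
      unfolding eval_right_def A1_def A0_def
      by (simp add: sum.distrib sum_distrib_right distrib_left mult.assoc)
  qed
  show thesis
  proof (cases "A1 = 0")
    case True
    \<comment> \<open>Here \<open>A0 = 0\<close> as well, and the choice \<open>h = 1\<close> gives
      \<open>m\<close> itself.\<close>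
    have "right_zero p m"
      using right[of 1] A0 True by (simp add: right_zero_def)
    then show thesis using quat_similar_refl by (rule that)
  next
    case False
    have "A1 * (inverse A1 * m * A1) = m * A1"
      using False by (simp flip: mult.assoc)
    then have "right_zero p (inverse A1 * m * A1)"
      using right[OF False] A0 by (simp add: right_zero_def)
    moreover have "quat_similar (inverse A1 * m * A1) m"
      unfolding quat_similar_def using False by blast
    ultimately show thesis by (rule that)
  qed
qed

section \<open>Invertible matrices over a noncommutative ring\<close>

text \<open>\<open>inverts_mat\<close> leaves the size of the inverse open; comparing the dimensions
  of the two products fixes it.\<close>

lemma invertible_matE:
  assumes "invertible_mat M" "M \<in> carrier_mat n n"
  obtains N where "N \<in> carrier_mat n n" "M * N = 1\<^sub>m n" "N * M = 1\<^sub>m n"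
proof -
  obtain N where N: "M * N = 1\<^sub>m n" "N * M = 1\<^sub>m (dim_row N)"
    using assms unfolding invertible_mat_def inverts_mat_def by auto
  have "dim_col N = n" using arg_cong[OF N(1), of dim_col] by simp
  moreover have "dim_row N = n" using arg_cong[OF N(2), of dim_col] assms by simp
  ultimately show thesis using that N by auto
qed

lemma mat_inv_eqI:
  assumes "M \<in> carrier_mat n n" "N \<in> carrier_mat n n" "M * N = 1\<^sub>m n" "N * M = 1\<^sub>m n"
  shows "mat_inv M = N"
  unfolding mat_inv_def
proof (rule the_equality)
  show "inverts_mat M N \<and> inverts_mat N M"
    using assms unfolding inverts_mat_def by auto
next
  fix K assume "inverts_mat M K \<and> inverts_mat K M"
  then have K: "M * K = 1\<^sub>m n" "K * M = 1\<^sub>m (dim_row K)"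
    using assms unfolding inverts_mat_def by auto
  have "dim_col K = n" using arg_cong[OF K(1), of dim_col] by simp
  moreover have "dim_row K = n" using arg_cong[OF K(2), of dim_col] assms by simp
  ultimately have "K \<in> carrier_mat n n" by auto
  then have "N * (M * K) = (N * M) * K" using assms by (intro assoc_mult_mat[symmetric])
  then show "K = N" using K assms \<open>K \<in> carrier_mat n n\<close> by simp
qed

lemma invertible_mat_mult:
  assumes "M \<in> carrier_mat n n" "N \<in> carrier_mat n n" "invertible_mat M" "invertible_mat N"
  shows "invertible_mat (M * N)"
proof -
  obtain M' where M': "M' \<in> carrier_mat n n" "M * M' = 1\<^sub>m n" "M' * M = 1\<^sub>m n"
    using assms invertible_matE by blast
  obtain N' where N': "N' \<in> carrier_mat n n" "N * N' = 1\<^sub>m n" "N' * N = 1\<^sub>m n"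
    using assms invertible_matE by blast
  have "M * N * (N' * M') = M * ((N * N') * M')" "N' * M' * (M * N) = N' * ((M' * M) * N)"
    using assms(1,2) M'(1) N'(1)
    by (simp_all only: assoc_mult_mat[of _ n n _ n _ n] mult_carrier_mat[of _ n n _ n])
  then show ?thesis
    using assms M' N' unfolding invertible_mat_def inverts_mat_def
    by (auto intro!: exI[of _ "N' * M'"])
qed

text \<open>Column \<open>j\<close> lists the coefficients of \<open>p\<close> from index
  \<open>j + 1\<close> on, so that column \<open>j\<close> of the controllability matrix times this
  one is the sum of \<open>A^k B p_(k+j+1)\<close> over \<open>k\<close>.\<close>

definition hankel_mat :: "'a::zero poly \<Rightarrow> 'a mat" where
  "hankel_mat p = mat (degree p) (degree p) (\<lambda>(i, j). coeff p (Suc (i + j)))"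

text \<open>Reversing the rows turns the Hankel matrix into the triangular Toeplitz matrix of the
  power series of the reflected polynomial; Toeplitz matrices multiply like power series.\<close>

lemma invertible_hankel_mat:
  fixes p :: "'a::division_ring poly"
  assumes "p \<noteq> 0"
  shows "invertible_mat (hankel_mat p)"
proof -
  define n where "n = degree p"
  define F where "F = Abs_fps (coeff (reflect_poly p))"
  define G where "G = inverse F"
  \<comment> \<open>The lower triangular Toeplitz matrix of \<open>G\<close> with its columns
    reversed; its support lies on and below the antidiagonal, that of the Hankel matrix on and above
    it.\<close>
  define V where "V = mat n n (\<lambda>(i, j). if n \<le> Suc (i + j) then fps_nth G (Suc (i + j) - n) else 0)"
  \<comment> \<open>The constant term of \<open>F\<close> is the leading coefficient of
    \<open>p\<close>.\<close>
  have "fps_nth F 0 \<noteq> 0" using assms by (simp add: F_def)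
  then have GF: "G * F = 1" and FG: "F * G = 1"
    unfolding G_def by (auto intro: inverse_mult_eq_1 inverse_mult_eq_1')
  have U: "hankel_mat p \<in> carrier_mat n n" and V: "V \<in> carrier_mat n n"
    by (simp_all add: hankel_mat_def V_def n_def)
  have u: "coeff p (Suc (i + j)) = (if i + j < n then fps_nth F (n - Suc (i + j)) else 0)" for i j
    by (auto simp: F_def n_def coeff_reflect_poly coeff_eq_0)
  have "hankel_mat p * V = 1\<^sub>m n"
  proof (rule eq_matI)
    fix i j assume "i < dim_row (1\<^sub>m n :: 'a mat)" "j < dim_col (1\<^sub>m n :: 'a mat)"
    then have ij: "i < n" "j < n" by auto
    have "(hankel_mat p * V) $$ (i, j) = (\<Sum>k<n. (if i + k < n then fps_nth F (n - Suc (i + k)) else 0)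
         * (if n \<le> Suc (k + j) then fps_nth G (Suc (k + j) - n) else 0))"
      using ij by (simp add: hankel_mat_def V_def scalar_prod_def atLeast0LessThan u flip: n_def
            cong: if_cong)
    also have "\<dots> = (\<Sum>k\<in>{n - Suc j..<n - i}. fps_nth F (n - Suc (i + k)) * fps_nth G (Suc (k + j) - n))"
      by (rule sum.mono_neutral_cong_right) auto
    also have "\<dots> = (if i \<le> j then fps_nth (F * G) (j - i) else 0)"
    proof (cases "i \<le> j")
      case True
      \<comment> \<open>Substituting \<open>q = n - 1 - i - k\<close> produces the Cauchy product at
        index \<open>j - i\<close>. For \<open>i > j\<close> the range of summation is
        empty.\<close>
      have "(\<Sum>k\<in>{n - Suc j..<n - i}. fps_nth F (n - Suc (i + k)) * fps_nth G (Suc (k + j) - n))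
          = (\<Sum>q = 0..j - i. fps_nth F q * fps_nth G (j - i - q))"
        using True ij
        by (intro sum.reindex_bij_witness[of _ "\<lambda>q. n - Suc (i + q)" "\<lambda>k. n - Suc (i + k)"])
           (auto intro!: arg_cong2[of _ _ _ _ "(*)"] arg_cong[of _ _ "fps_nth G"])
      then show ?thesis using True by (simp add: fps_mult_nth)
    qed simp
    also have "\<dots> = 1\<^sub>m n $$ (i, j)" using ij by (auto simp: FG)
    finally show "(hankel_mat p * V) $$ (i, j) = 1\<^sub>m n $$ (i, j)" .
  qed (use U V in auto)
  moreover have "V * hankel_mat p = 1\<^sub>m n"
  proof (rule eq_matI)
    fix i j assume "i < dim_row (1\<^sub>m n :: 'a mat)" "j < dim_col (1\<^sub>m n :: 'a mat)"
    then have ij: "i < n" "j < n" by auto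
    have "(V * hankel_mat p) $$ (i, j) = (\<Sum>k<n. (if n \<le> Suc (i + k) then fps_nth G (Suc (i + k) - n) else 0)
         * (if k + j < n then fps_nth F (n - Suc (k + j)) else 0))"
      using ij by (simp add: hankel_mat_def V_def scalar_prod_def atLeast0LessThan u flip: n_def
            cong: if_cong)
    also have "\<dots> = (\<Sum>k\<in>{n - Suc i..<n - j}. fps_nth G (Suc (i + k) - n) * fps_nth F (n - Suc (k + j)))"
      by (rule sum.mono_neutral_cong_right) auto
    also have "\<dots> = (if j \<le> i then fps_nth (G * F) (i - j) else 0)"
    proof (cases "j \<le> i")
      case True
      have "(\<Sum>k\<in>{n - Suc i..<n - j}. fps_nth G (Suc (i + k) - n) * fps_nth F (n - Suc (k + j)))
          = (\<Sum>q = 0..i - j. fps_nth G q * fps_nth F (i - j - q))"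
        using True ij
        by (intro sum.reindex_bij_witness[of _ "\<lambda>q. q + n - Suc i" "\<lambda>k. Suc (i + k) - n"])
           (auto intro!: arg_cong2[of _ _ _ _ "(*)"] arg_cong[of _ _ "fps_nth F"])
      then show ?thesis using True by (simp add: fps_mult_nth)
    qed simp
    also have "\<dots> = 1\<^sub>m n $$ (i, j)" using ij by (auto simp: GF)
    finally show "(V * hankel_mat p) $$ (i, j) = 1\<^sub>m n $$ (i, j)" .
  qed (use U V in auto)
  ultimately show ?thesis
    using U V unfolding invertible_mat_def inverts_mat_def by auto
qed

section \<open>The companion transformation\<close>

definition monic_poly :: "nat \<Rightarrow> (nat \<Rightarrow> 'a::semiring_1) \<Rightarrow> 'a poly" where
  "monic_poly n a = (\<Sum>i<n. monom (a i) i) + monom 1 n"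

lemma coeff_monic_poly:
  "coeff (monic_poly n a) k = (if k < n then a k else if k = n then 1 else 0)"
proof -
  have "(\<Sum>i<n. coeff (monom (a i) i) k) = (if k < n then a k else 0)"
    by (simp add: coeff_monom sum.delta' cong: if_cong)
  then show ?thesis by (auto simp: monic_poly_def coeff_sum coeff_monom)
qed

lemma degree_monic_poly: "degree (monic_poly n (a :: nat \<Rightarrow> 'a::semiring_1)) = n"
  by (rule antisym) (auto intro!: degree_le le_degree simp: coeff_monic_poly)

text \<open>Multiplying by a companion matrix on the right shifts the columns by one and subtracts
  right multiples of the last column.\<close>

lemma companion_mat_mult:
  assumes "M \<in> carrier_mat n n" "i < n" "j < n"
  shows "(M * lower_companion_mat n a) $$ (i, j) =
    (if j = 0 then 0 else M $$ (i, j - 1)) - M $$ (i, n - 1) * a j"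
proof -
  have "(M * lower_companion_mat n a) $$ (i, j) =
    (\<Sum>l<n. M $$ (i, l) * (if l = n - 1 then - a j else if j = l + 1 then 1 else 0))"
    using assms by (simp add: lower_companion_mat_def scalar_prod_def atLeast0LessThan)
  \<comment> \<open>For \<open>j > 0\<close> the rows \<open>n - 1\<close> and \<open>j - 1\<close>
    differ because \<open>j < n\<close>. For \<open>j = 0\<close> the truncated \<open>j - 1\<close>
    is \<open>0\<close>, and the inner conditional makes that term vanish.\<close>
  also have "\<dots> = (\<Sum>l<n. (if l = n - 1 then - (M $$ (i, n - 1) * a j) else 0)
      + (if l = j - 1 then if j = 0 then 0 else M $$ (i, j - 1) else 0))"
    using assms by (intro sum.cong) auto
  also have "\<dots> = (if j = 0 then 0 else M $$ (i, j - 1)) - M $$ (i, n - 1) * a j"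
    using assms by (simp add: sum.distrib less_imp_diff_less)
  finally show ?thesis .
qed

lemma companion_mat_mult_vec:
  assumes "v \<in> carrier_vec n" "i < n"
  shows "(lower_companion_mat n a *\<^sub>v v) $ i =
    (if Suc i < n then v $ Suc i else - (\<Sum>j<n. a j * v $ j))"
proof (cases "Suc i < n")
  case True
  have "(lower_companion_mat n a *\<^sub>v v) $ i =
    (\<Sum>j<n. (if i = n - 1 then - a j else if j = i + 1 then 1 else 0) * v $ j)"
    using assms by (simp add: lower_companion_mat_def scalar_prod_def atLeast0LessThan)
  also have "\<dots> = (\<Sum>j<n. if j = Suc i then v $ Suc i else 0)"
    using True by (intro sum.cong) auto
  finally show ?thesis using True by simp
next
  case False
  then have "i = n - 1" using assms by simp
  then show ?thesis
    using assms False
    by (simp add: lower_companion_mat_def scalar_prod_def atLeast0LessThan sum_negf)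
qed

section \<open>Krylov vectors and the column recursion\<close>

locale control_pair =
  fixes n :: nat and A :: "quat mat" and B :: "quat vec"
  assumes n: "1 \<le> n" and A: "A \<in> carrier_mat n n" and B: "B \<in> carrier_vec n"
begin

abbreviation krylov :: "nat \<Rightarrow> quat vec" where
  "krylov k \<equiv> (A ^\<^sub>m k) *\<^sub>v B"

text \<open>Matrix powers append the new factor on the right; here it has to be moved to the
  left.\<close>

lemma krylov_Suc: "krylov (Suc k) = A *\<^sub>v krylov k"
proof -
  have "A ^\<^sub>m Suc k = A * A ^\<^sub>m k"
  proof (induction k)
    case (Suc k)
    have "A ^\<^sub>m Suc (Suc k) = A * A ^\<^sub>m k * A" using Suc by simp
    then show ?case using A by (simp add: assoc_mult_mat[of _ n n _ n _ n])
  qed (use A in simp)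
  then show ?thesis using A B by (simp add: assoc_mult_mat_vec[of _ n n _ n])
qed

lemma controllability_mat_carrier: "controllability_mat A B \<in> carrier_mat n n"
  using A mat_of_cols_carrier(1)[of n "map krylov [0..<n]"]
  by (simp add: controllability_mat_def)

lemma controllability_mat_index:
  "i < n \<Longrightarrow> k < n \<Longrightarrow> controllability_mat A B $$ (i, k) = krylov k $ i"
  using A by (simp add: controllability_mat_def mat_of_cols_def)

lemma mult_controllability_mat_index:
  assumes "i < n" "k < n"
  shows "(A * controllability_mat A B) $$ (i, k) = krylov (Suc k) $ i"
proof -
  have "col (controllability_mat A B) k = krylov k"
    using assms A B controllability_mat_carrier
    by (intro eq_vecI) (auto simp: controllability_mat_index)
  then show ?thesis
    using assms A controllability_mat_carrier by (simp add: krylov_Suc del: pow_mat.simps)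
qed

text \<open>For \<open>j > 0\<close> the right-hand side is entry \<open>(i, j - 1)\<close> of the same matrix product, so this is
  the recursion that characterises the columns of the companion transformation.\<close>

lemma krylov_recursion:
  assumes "degree p = n" "i < n" "j < n"
  shows "(A * (controllability_mat A B * hankel_mat p)) $$ (i, j) + B $ i * coeff p j
    = (\<Sum>k\<le>n. krylov k $ i * coeff p (k + j))"
proof -
  have H: "hankel_mat p \<in> carrier_mat n n" using assms by (simp add: hankel_mat_def)
  have "A * (controllability_mat A B * hankel_mat p) = A * controllability_mat A B * hankel_mat p"
    using A H controllability_mat_carrier by (simp add: assoc_mult_mat[of _ n n _ n _ n])
  also have "\<dots> $$ (i, j) = (\<Sum>k<n. (A * controllability_mat A B) $$ (i, k) * hankel_mat p $$ (k, j))"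
    using assms A H controllability_mat_carrier
    by (simp add: scalar_prod_def atLeast0LessThan del: assoc_mult_mat)
  also have "\<dots> = (\<Sum>k<n. krylov (Suc k) $ i * coeff p (Suc k + j))"
    using assms by (intro sum.cong) (simp_all add: mult_controllability_mat_index hankel_mat_def
        del: index_mult_mat pow_mat.simps)
  \<comment> \<open>The summand with \<open>B\<close> is the term \<open>k = 0\<close> that the
    index shift leaves out.\<close>
  finally show ?thesis
    using A B by (simp add: lessThan_Suc_atMost[symmetric] sum.lessThan_Suc_shift del: sum.lessThan_Suc pow_mat.simps(2))
qed

text \<open>The term \<open>k = n\<close> is zero since the coefficient index exceeds the degree;
  including it matches the range in \<open>krylov_recursion\<close>.\<close>

lemma controllability_hankel_index:
  assumes "degree p = n" "i < n" "j < n"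
  shows "(controllability_mat A B * hankel_mat p) $$ (i, j)
    = (\<Sum>k\<le>n. krylov k $ i * coeff p (Suc (k + j)))"
proof -
  have H: "hankel_mat p \<in> carrier_mat n n" using assms by (simp add: hankel_mat_def)
  have "(controllability_mat A B * hankel_mat p) $$ (i, j)
      = (\<Sum>k<n. krylov k $ i * coeff p (Suc (k + j)))"
    using assms H controllability_mat_carrier
    by (simp add: scalar_prod_def atLeast0LessThan controllability_mat_index)
       (simp add: hankel_mat_def)
  also have "\<dots> = (\<Sum>k\<le>n. krylov k $ i * coeff p (Suc (k + j)))"
    using assms by (simp add: lessThan_Suc_atMost[symmetric] coeff_eq_0)
  finally show ?thesis .
qed

text \<open>Read by columns, the left side says that the last column is \<open>B\<close> and that
  column \<open>j - 1\<close> is \<open>A\<close> times column \<open>j\<close> plus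
  \<open>B\<close> times coefficient \<open>j\<close>. This determines \<open>T\<close> from right
  to left, and column \<open>0\<close> leaves the annihilation condition.\<close>

lemma companion_transform_iff:
  assumes T: "T \<in> carrier_mat n n" and p: "degree p = n" "lead_coeff p = 1"
  shows "A * T = T * lower_companion_mat n (coeff p) \<and> T *\<^sub>v unit_vec n (n - 1) = B
    \<longleftrightarrow> T = controllability_mat A B * hankel_mat p \<and>
      (\<forall>i<n. (\<Sum>k\<le>n. krylov k $ i * coeff p k) = 0)" (is "?L \<longleftrightarrow> ?R")
proof -
  define W where "W = controllability_mat A B * hankel_mat p"
  have W: "W \<in> carrier_mat n n"
    using p controllability_mat_carrier by (simp add: W_def hankel_mat_def)
  have unit: "(M *\<^sub>v unit_vec n (n - 1)) $ i = M $$ (i, n - 1)"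
    if "M \<in> carrier_mat n n" "i < n" for M :: "quat mat" and i
    using that n by (simp add: scalar_prod_right_unit)
  have rec: "(A * W) $$ (i, j) + B $ i * coeff p j =
      (if j = 0 then \<Sum>k\<le>n. krylov k $ i * coeff p k else W $$ (i, j - 1))"
    if "i < n" "j < n" for i j
    using krylov_recursion[OF p(1) that] controllability_hankel_index[OF p(1), of i "j - 1"] that
    unfolding W_def by simp
  have last: "W $$ (i, n - 1) = B $ i" if "i < n" for i
  proof -
    have "W $$ (i, n - 1) = (\<Sum>k\<le>n. krylov k $ i * coeff p (k + n))"
      using controllability_hankel_index[OF p(1) that, of "n - 1"] n by (simp add: W_def)
    also have "\<dots> = (\<Sum>k\<le>n. if k = 0 then B $ i else 0)"
    proof (rule sum.cong)
      fix k
      have "krylov 0 = B" using A B by simp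
      then show "krylov k $ i * coeff p (k + n) = (if k = 0 then B $ i else 0)"
        using p by (auto simp: coeff_eq_0 simp del: index_mult_mat_vec pow_mat.simps)
    qed simp
    finally show ?thesis by simp
  qed
  show ?thesis
  proof
    assume R: ?R
    then have TW: "T = W" by (simp add: W_def)
    have "A * W = W * lower_companion_mat n (coeff p)"
    proof (rule eq_matI)
      fix i j
      assume "i < dim_row (W * lower_companion_mat n (coeff p))"
        "j < dim_col (W * lower_companion_mat n (coeff p))"
      then have ij: "i < n" "j < n" using W by (auto simp: lower_companion_mat_def)
      show "(A * W) $$ (i, j) = (W * lower_companion_mat n (coeff p)) $$ (i, j)"
        unfolding companion_mat_mult[OF W ij] last[OF ij(1)]
        using rec[OF ij] R ij by (simp add: eq_diff_eq)
    qed (use A W in \<open>auto simp: lower_companion_mat_def\<close>)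
    moreover have "W *\<^sub>v unit_vec n (n - 1) = B"
      using W B by (intro eq_vecI) (auto simp: unit last simp del: index_mult_mat_vec One_nat_def)
    ultimately show ?L by (simp add: TW)
  next
    assume L: ?L
    have lastT: "T $$ (i, n - 1) = B $ i" if "i < n" for i
      using L unit[OF T that] by simp
    have recT: "(A * T) $$ (i, j) + B $ i * coeff p j = (if j = 0 then 0 else T $$ (i, j - 1))"
      if "i < n" "j < n" for i j
      using L companion_mat_mult[OF T that, of "coeff p"] lastT[OF that(1)] by simp
    \<comment> \<open>Column \<open>j\<close> of the product depends only on column \<open>j\<close>
      of the right factor.\<close>
    have cong: "(A * T) $$ (i, j) = (A * W) $$ (i, j)"
      if "\<And>i. i < n \<Longrightarrow> T $$ (i, j) = W $$ (i, j)" "i < n" "j < n" for i j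
      using that A T W by (auto simp: scalar_prod_def)
    \<comment> \<open>The induction on \<open>d\<close> starts at the last column and moves
      left.\<close>
    have eq: "\<forall>i<n. T $$ (i, n - 1 - d) = W $$ (i, n - 1 - d)" if "d < n" for d
      using that
    proof (induction d)
      case 0
      then show ?case by (simp add: last lastT del: One_nat_def)
    next
      case (Suc d)
      let ?j = "n - 1 - d"
      have j: "?j < n" "?j \<noteq> 0" "n - 1 - Suc d = ?j - 1" using Suc.prems by auto
      show ?case
      proof (intro allI impI)
        fix i assume i: "i < n"
        have "(A * T) $$ (i, ?j) = (A * W) $$ (i, ?j)"
          using Suc i by (intro cong) auto
        then show "T $$ (i, n - 1 - Suc d) = W $$ (i, n - 1 - Suc d)"
          using recT[OF i j(1)] rec[OF i j(1)] j by simp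
      qed
    qed
    have TW: "T = W"
    proof (rule eq_matI)
      fix i j assume "i < dim_row W" "j < dim_col W"
      then show "T $$ (i, j) = W $$ (i, j)"
        using eq[of "n - 1 - j"] W by auto
    qed (use T W in auto)
    have "(\<Sum>k\<le>n. krylov k $ i * coeff p k) = 0" if "i < n" for i
      using recT[of i 0] rec[of i 0] that n TW by simp
    then show ?R using TW by (simp add: W_def)
  qed
qed

section \<open>The annihilating polynomial and the transformation it yields\<close>

text \<open>The coefficients below \<open>n\<close> solve a linear system with the controllability
  matrix and right-hand side \<open>- krylov n\<close>. A left inverse makes the solution
  unique.\<close>

lemma companion_poly_unique:
  assumes "controllable A B"
    and p: "degree p = n" "lead_coeff p = 1" "\<forall>i<n. (\<Sum>k\<le>n. krylov k $ i * coeff p k) = 0"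
    and q: "degree q = n" "lead_coeff q = 1" "\<forall>i<n. (\<Sum>k\<le>n. krylov k $ i * coeff q k) = 0"
  shows "p = q"
proof -
  let ?C = "controllability_mat A B"
  obtain D where D: "D \<in> carrier_mat n n" "D * ?C = 1\<^sub>m n"
    using assms(1) controllability_mat_carrier invertible_matE unfolding controllable_def by blast
  have "?C *\<^sub>v vec n (coeff r) = - krylov n"
    if "degree r = n" "lead_coeff r = 1" "\<forall>i<n. (\<Sum>k\<le>n. krylov k $ i * coeff r k) = 0" for r
  proof (rule eq_vecI)
    fix i assume "i < dim_vec (- krylov n)"
    then have i: "i < n" using A by simp
    have "(?C *\<^sub>v vec n (coeff r)) $ i = (\<Sum>k<n. krylov k $ i * coeff r k)"
      using i controllability_mat_carrier
      by (simp add: scalar_prod_def atLeast0LessThan controllability_mat_index)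
    moreover have "(\<Sum>k\<le>n. krylov k $ i * coeff r k) = (\<Sum>k<n. krylov k $ i * coeff r k) + krylov n $ i"
      using that by (simp add: lessThan_Suc_atMost[symmetric])
    ultimately show "(?C *\<^sub>v vec n (coeff r)) $ i = (- krylov n) $ i"
      using that(3) i A by (simp add: eq_neg_iff_add_eq_0 del: index_mult_mat_vec)
  qed (use A controllability_mat_carrier in auto)
  then have "?C *\<^sub>v vec n (coeff p) = ?C *\<^sub>v vec n (coeff q)" using p q by simp
  moreover have "D *\<^sub>v (?C *\<^sub>v vec n f) = vec n f" for f
    using assoc_mult_mat_vec[OF D(1) controllability_mat_carrier, of "vec n f"] D(2) by simp
  ultimately have v: "vec n (coeff p) = vec n (coeff q)" by metis
  have "coeff p k = coeff q k" for k
  proof (cases k n rule: linorder_cases)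
    case less
    then show ?thesis using arg_cong[OF v, of "\<lambda>w. w $ k"] by simp
  qed (use p q in \<open>auto simp: coeff_eq_0\<close>)
  then show ?thesis by (rule poly_eqI)
qed

text \<open>A right inverse of the controllability matrix solves the same system.\<close>

lemma annihilating_poly_exists:
  assumes "controllable A B"
  shows "\<exists>a. \<forall>i<n. (\<Sum>k\<le>n. krylov k $ i * coeff (monic_poly n a) k) = 0"
proof -
  let ?C = "controllability_mat A B"
  obtain D where D: "D \<in> carrier_mat n n" "?C * D = 1\<^sub>m n"
    using assms controllability_mat_carrier invertible_matE unfolding controllable_def by blast
  define w where "w = D *\<^sub>v (- krylov n)"
  have kn: "- krylov n \<in> carrier_vec n"
    using mult_mat_vec_carrier[OF pow_carrier_mat[OF A] B] by simp
  have w: "w \<in> carrier_vec n" unfolding w_def by (rule mult_mat_vec_carrier[OF D(1) kn])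
  have "?C *\<^sub>v w = (?C * D) *\<^sub>v (- krylov n)"
    unfolding w_def by (rule assoc_mult_mat_vec[symmetric, OF controllability_mat_carrier D(1) kn])
  then have Cw: "?C *\<^sub>v w = - krylov n" unfolding D(2) using kn by simp
  have "(\<Sum>k\<le>n. krylov k $ i * coeff (monic_poly n (($) w)) k) = 0" if i: "i < n" for i
  proof -
    have "(\<Sum>k<n. krylov k $ i * w $ k) = (?C *\<^sub>v w) $ i"
      using i controllability_mat_carrier w
      by (simp add: scalar_prod_def atLeast0LessThan controllability_mat_index)
    also have "\<dots> = - (krylov n $ i)" unfolding Cw using i A by simp
    finally show ?thesis
      by (simp add: lessThan_Suc_atMost[symmetric] coeff_monic_poly)
  qed
  then show ?thesis by blast
qed

text \<open>Multiplying by \<open>T\<close> or \<open>S\<close> on the left passes between the two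
  systems; the second is free of the inverse and open to the column recursion.\<close>

lemma companion_form_iff:
  assumes "T \<in> carrier_mat n n" "S \<in> carrier_mat n n" "T * S = 1\<^sub>m n" "S * T = 1\<^sub>m n"
  shows "S * A * T = lower_companion_mat n a \<and> S *\<^sub>v B = unit_vec n (n - 1) \<longleftrightarrow>
    A * T = T * lower_companion_mat n a \<and> T *\<^sub>v unit_vec n (n - 1) = B"
proof -
  let ?L = "lower_companion_mat n a" and ?e = "unit_vec n (n - 1) :: quat vec"
  have L: "?L \<in> carrier_mat n n" by (simp add: lower_companion_mat_def)
  have e: "?e \<in> carrier_vec n" by simp
  have AT: "A * T \<in> carrier_mat n n" and TL: "T * ?L \<in> carrier_mat n n"
    using A L assms by auto
  have "S * A * T = S * (A * T)"
    using A assms by (simp add: assoc_mult_mat[of _ n n _ n _ n])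
  moreover have "T * (S * (A * T)) = A * T"
    using assoc_mult_mat[OF assms(1,2) AT] assms(3) left_mult_one_mat[OF AT] by simp
  moreover have "S * (T * ?L) = ?L"
    using assoc_mult_mat[OF assms(2,1) L] assms(4) L by simp
  moreover have "T *\<^sub>v (S *\<^sub>v B) = B"
    using assoc_mult_mat_vec[OF assms(1,2) B] assms(3) B by simp
  moreover have "S *\<^sub>v (T *\<^sub>v ?e) = ?e"
    using assoc_mult_mat_vec[OF assms(2,1) e] assms(4) e by simp
  ultimately show ?thesis by metis
qed

text \<open>Resolves the definite description in \<open>companion_transform\<close>: its predicate
  \<open>P\<close> holds exactly for invertible products of the controllability matrix with the
  Hankel matrix of an annihilating polynomial, and there is only one such polynomial.\<close>

lemma companion_transform_obtain:
  assumes "controllable A B"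
  obtains T S a where "T \<in> carrier_mat n n" "S \<in> carrier_mat n n" "T * S = 1\<^sub>m n" "S * T = 1\<^sub>m n"
    "A * T = T * lower_companion_mat n a" "companion_poly A B = monic_poly n a"
proof -
  let ?C = "controllability_mat A B"
  define P where "P T \<longleftrightarrow> T \<in> carrier_mat n n \<and> invertible_mat T \<and>
    lower_companion_form n (mat_inv T * A * T) (mat_inv T *\<^sub>v B)" for T
  have dim: "dim_row A = n" using A by simp
  \<comment> \<open>The companion matrix reads only coefficients below \<open>n\<close>, so the
    leading \<open>1\<close> does not affect it.\<close>
  have lcm: "lower_companion_mat n (coeff (monic_poly n a)) = lower_companion_mat n a" for a
    by (auto simp: lower_companion_mat_def coeff_monic_poly intro!: eq_matI)
  have P: "P T \<longleftrightarrow> T \<in> carrier_mat n n \<and> invertible_mat T \<and>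
    (\<exists>a. T = ?C * hankel_mat (monic_poly n a) \<and>
      (\<forall>i<n. (\<Sum>k\<le>n. krylov k $ i * coeff (monic_poly n a) k) = 0))" for T
  proof (cases "T \<in> carrier_mat n n \<and> invertible_mat T")
    case True
    then obtain S where S: "S \<in> carrier_mat n n" "T * S = 1\<^sub>m n" "S * T = 1\<^sub>m n"
      using invertible_matE by blast
    have inv: "mat_inv T = S" using True S by (intro mat_inv_eqI) auto
    have "lower_companion_form n (S * A * T) (S *\<^sub>v B) \<longleftrightarrow>
      (\<exists>a. A * T = T * lower_companion_mat n a \<and> T *\<^sub>v unit_vec n (n - 1) = B)"
      unfolding lower_companion_form_def using companion_form_iff[of T S] True S by blast
    also have "\<dots> \<longleftrightarrow> (\<exists>a. T = ?C * hankel_mat (monic_poly n a) \<and>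
      (\<forall>i<n. (\<Sum>k\<le>n. krylov k $ i * coeff (monic_poly n a) k) = 0))"
      using companion_transform_iff[of T "monic_poly n _"] True
      by (simp add: degree_monic_poly coeff_monic_poly lcm)
    finally show ?thesis using True inv by (simp add: P_def)
  qed (auto simp: P_def)
  obtain a where a: "\<forall>i<n. (\<Sum>k\<le>n. krylov k $ i * coeff (monic_poly n a) k) = 0"
    using annihilating_poly_exists[OF assms] by blast
  define T where "T = ?C * hankel_mat (monic_poly n a)"
  have H: "hankel_mat (monic_poly n a) \<in> carrier_mat n n"
    by (simp add: hankel_mat_def degree_monic_poly)
  have ne: "monic_poly n a \<noteq> 0"
    using coeff_monic_poly[of n a n] by auto
  have T: "T \<in> carrier_mat n n" and invT: "invertible_mat T"
    using H controllability_mat_carrier assms invertible_hankel_mat[OF ne]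
    by (auto simp: T_def controllable_def intro!: invertible_mat_mult[of _ n])
  have PT: "P T" unfolding P using T invT a T_def by blast
  have uniq: "T' = T" if "P T'" for T'
  proof -
    obtain b where b: "T' = ?C * hankel_mat (monic_poly n b)"
      "\<forall>i<n. (\<Sum>k\<le>n. krylov k $ i * coeff (monic_poly n b) k) = 0"
      using \<open>P T'\<close> unfolding P by blast
    have "monic_poly n b = monic_poly n a"
      using companion_poly_unique[OF assms _ _ b(2) _ _ a]
      by (simp add: degree_monic_poly coeff_monic_poly)
    then show ?thesis using b by (simp add: T_def)
  qed
  have the: "companion_transform A B = T"
    unfolding companion_transform_def dim by (rule the_equality) (use PT uniq P_def in blast)+
  obtain S where S: "S \<in> carrier_mat n n" "T * S = 1\<^sub>m n" "S * T = 1\<^sub>m n"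
    using T invT invertible_matE by blast
  have inv: "mat_inv T = S" using T S by (intro mat_inv_eqI) auto
  have AT: "A * T = T * lower_companion_mat n a \<and> T *\<^sub>v unit_vec n (n - 1) = B"
    using companion_transform_iff[OF T, of "monic_poly n a"] a
    by (simp add: degree_monic_poly coeff_monic_poly lcm T_def)
  then have SAT: "S * A * T = lower_companion_mat n a"
    using companion_form_iff[OF T S] by blast
  have "companion_poly A B = monic_poly n a"
    unfolding companion_poly_def dim the Let_def inv SAT monic_poly_def
    using n by (auto simp: lower_companion_mat_def intro!: sum.cong)
  then show thesis using that T S AT by blast
qed

end

section \<open>Right eigenvalues\<close>

text \<open>\<open>T\<close> carries eigenvectors of \<open>L\<close> to eigenvectors of
  \<open>A\<close>, because scaling on the right commutes with matrices acting on the left. The left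
  inverse \<open>S\<close> keeps the image nonzero.\<close>

lemma right_eigenvalue_similarity:
  assumes "A \<in> carrier_mat n n" "T \<in> carrier_mat n n" "S \<in> carrier_mat n n" "L \<in> carrier_mat n n"
    and "S * T = 1\<^sub>m n" "A * T = T * L" "right_eigenvalue L l"
  shows "right_eigenvalue A l"
proof -
  obtain v where v: "v \<in> carrier_vec n" "v \<noteq> 0\<^sub>v n" "L *\<^sub>v v = map_vec (\<lambda>x. x * l) v"
    using assms unfolding right_eigenvalue_def by auto
  have "A *\<^sub>v (T *\<^sub>v v) = T *\<^sub>v (L *\<^sub>v v)"
    using assms v by (metis assoc_mult_mat_vec)
  also have "\<dots> = map_vec (\<lambda>x. x * l) (T *\<^sub>v v)"
    unfolding v(3) using assms v
    by (intro eq_vecI) (auto simp: scalar_prod_def sum_distrib_right mult.assoc)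
  finally have "A *\<^sub>v (T *\<^sub>v v) = map_vec (\<lambda>x. x * l) (T *\<^sub>v v)" .
  moreover have "T *\<^sub>v v \<noteq> 0\<^sub>v n"
  proof
    assume "T *\<^sub>v v = 0\<^sub>v n"
    then have "S *\<^sub>v (T *\<^sub>v v) = S *\<^sub>v 0\<^sub>v n" by simp
    also have "S *\<^sub>v 0\<^sub>v n = 0\<^sub>v n" using assms by (intro eq_vecI) auto
    also have "S *\<^sub>v (T *\<^sub>v v) = v"
      using assoc_mult_mat_vec[OF assms(3,2) v(1)] assms(5) v(1) by simp
    finally show False using v by simp
  qed
  moreover have "T *\<^sub>v v \<in> carrier_vec n" by (rule mult_mat_vec_carrier[OF assms(2) v(1)])
  ultimately show ?thesis using assms unfolding right_eigenvalue_def by auto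
qed

lemma eval_right_monic_poly:
  "eval_right (monic_poly n a) q = (\<Sum>k<n. a k * q ^ k) + q ^ n"
  by (simp add: eval_right_def degree_monic_poly coeff_monic_poly lessThan_Suc_atMost[symmetric])

text \<open>Scaling an eigenvector on the right by \<open>h\<close> turns the eigenvalue
  \<open>l\<close> into \<open>inverse h * l * h\<close>. Normalising the first entry to
  \<open>1\<close> therefore replaces \<open>l\<close> by a similar \<open>q\<close>, and the last
  row becomes the equation for a right zero.\<close>

lemma right_eigenvalue_companion_mat_iff:
  assumes "1 \<le> n"
  shows "right_eigenvalue (lower_companion_mat n a) l \<longleftrightarrow>
    (\<exists>q. right_zero (monic_poly n a) q \<and> quat_similar l q)"
proof
  let ?L = "lower_companion_mat n a"
  have dim: "dim_row ?L = n" by (simp add: lower_companion_mat_def)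
  assume "right_eigenvalue ?L l"
  then obtain v where v: "v \<in> carrier_vec n" "v \<noteq> 0\<^sub>v n" "?L *\<^sub>v v = map_vec (\<lambda>x. x * l) v"
    unfolding right_eigenvalue_def dim by blast
  have entry: "(if Suc i < n then v $ Suc i else - (\<Sum>j<n. a j * v $ j)) = v $ i * l" if "i < n" for i
    using companion_mat_mult_vec[OF v(1) that, of a] v that by simp
  have pow: "v $ i = v $ 0 * l ^ i" if "i < n" for i
    using that
  proof (induction i)
    case (Suc i)
    then show ?case using entry[of i] by (simp add: mult.assoc power_commutes)
  qed simp
  have v0: "v $ 0 \<noteq> 0"
  proof
    assume "v $ 0 = 0"
    then have "v = 0\<^sub>v n" using v(1) pow by (intro eq_vecI) auto
    then show False using v by simp
  qed
  define h where "h = inverse (v $ 0)"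
  have h: "h \<noteq> 0" using v0 by (simp add: h_def)
  define q where "q = inverse h * l * h"
  have hv: "h * v $ 0 = 1" "inverse h = v $ 0" using v0 by (simp_all add: h_def)
  \<comment> \<open>Since \<open>q\<close> is \<open>l\<close> conjugated by the first entry,
    \<open>q ^ k * v $ 0\<close> is entry \<open>k\<close> of \<open>v\<close> for
    \<open>k < n\<close>; the factor \<open>c\<close> makes room for a coefficient.\<close>
  have tm: "c * q ^ k * v $ 0 = c * (v $ 0 * l ^ k)" for c k
    unfolding q_def quat_power_conj[OF h] unfolding hv(2) using hv(1) by (simp add: mult.assoc)
  have "eval_right (monic_poly n a) q * v $ 0 = (\<Sum>j<n. a j * v $ j) + v $ 0 * l ^ n"
  proof -
    have "(\<Sum>j<n. a j * q ^ j * v $ 0) = (\<Sum>j<n. a j * v $ j)"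
      by (intro sum.cong) (auto simp only: tm pow[symmetric] lessThan_iff)
    then show ?thesis
      using tm[of 1 n] by (simp add: eval_right_monic_poly distrib_right sum_distrib_right)
  qed
  also have "v $ 0 * l ^ n = v $ (n - 1) * l"
    using pow[of "n - 1"] power_Suc2[of l "n - 1"] assms by (simp add: mult.assoc del: power_Suc)
  also have "v $ (n - 1) * l = - (\<Sum>j<n. a j * v $ j)"
    using entry[of "n - 1"] assms by simp
  finally have "right_zero (monic_poly n a) q" using v0 by (simp add: right_zero_def)
  moreover have "quat_similar l q"
    by (rule quat_similar_sym) (use h q_def in \<open>auto simp: quat_similar_def\<close>)
  ultimately show "\<exists>q. right_zero (monic_poly n a) q \<and> quat_similar l q" by blast
next
  let ?L = "lower_companion_mat n a"
  assume "\<exists>q. right_zero (monic_poly n a) q \<and> quat_similar l q"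
  then obtain q h where q: "right_zero (monic_poly n a) q" and h: "h \<noteq> 0" "l = inverse h * q * h"
    unfolding quat_similar_def by blast
  \<comment> \<open>The powers of \<open>q\<close> form an eigenvector for \<open>q\<close>; the
    factor \<open>h\<close> on the right changes the eigenvalue to \<open>l\<close>.\<close>
  define v where "v = vec n (\<lambda>i. q ^ i * h)"
  have v: "v \<in> carrier_vec n" by (simp add: v_def)
  have hl: "h * l = q * h" using h by (simp flip: mult.assoc)
  have "v $ 0 \<noteq> 0\<^sub>v n $ 0" using assms h by (simp add: v_def)
  then have "v \<noteq> 0\<^sub>v n" by metis
  moreover have "?L *\<^sub>v v = map_vec (\<lambda>x. x * l) v"
  proof (rule eq_vecI)
    fix i assume "i < dim_vec (map_vec (\<lambda>x. x * l) v)"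
    then have i: "i < n" by (simp add: v_def)
    have "(\<Sum>j<n. a j * v $ j) + q ^ n * h = 0"
    proof -
      have "((\<Sum>j<n. a j * q ^ j) + q ^ n) * h = 0"
        using q by (simp add: right_zero_def eval_right_monic_poly)
      then show ?thesis by (simp add: v_def distrib_right sum_distrib_right mult.assoc)
    qed
    \<comment> \<open>Only the last row is concerned, where \<open>Suc i = n\<close>.\<close>
    moreover have "q ^ n * h = q ^ Suc i * h" if "\<not> Suc i < n"
      using that i by (metis Suc_lessI)
    moreover have "v $ i * l = q ^ Suc i * h"
      using i hl by (simp add: v_def mult.assoc power_Suc2 del: power_Suc)
    ultimately show "(?L *\<^sub>v v) $ i = map_vec (\<lambda>x. x * l) v $ i"
      unfolding companion_mat_mult_vec[OF v i] using i
      by (auto simp: v_def neg_eq_iff_add_eq_0)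
  qed (simp add: v_def lower_companion_mat_def)
  ultimately show "right_eigenvalue ?L l"
    using v unfolding right_eigenvalue_def by (auto simp: lower_companion_mat_def)
qed

theorem theorem4:
  fixes n :: nat and A :: "quat mat" and B :: "quat vec"
  assumes "n \<ge> 1"
    and "A \<in> carrier_mat n n"
    and "B \<in> carrier_vec n"
    and "controllable A B"
  shows "(\<forall>l. right_zero (companion_poly A B) l \<longrightarrow> right_eigenvalue A l)
    \<and> right_spectrum A = {similarity_class l | l. right_zero (companion_poly A B) l}
    \<and> (\<forall>m. left_zero (companion_poly A B) m \<longrightarrow> right_eigenvalue A m)"
proof -
  interpret control_pair n A B by unfold_locales (use assms in auto)
  obtain T S a where T: "T \<in> carrier_mat n n" and S: "S \<in> carrier_mat n n"
    and inv: "T * S = 1\<^sub>m n" "S * T = 1\<^sub>m n"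
    and AT: "A * T = T * lower_companion_mat n a" and poly: "companion_poly A B = monic_poly n a"
    using companion_transform_obtain[OF assms(4)] by blast
  let ?L = "lower_companion_mat n a"
  have L: "?L \<in> carrier_mat n n" by (simp add: lower_companion_mat_def)
  \<comment> \<open>The intertwining relation for the inverse, by which eigenvalues also pass from
    \<open>A\<close> to the companion matrix.\<close>
  have "?L * S = S * A"
  proof -
    have "S * A * (T * S) = S * (A * T) * S" "S * (T * ?L) * S = (S * T) * ?L * S"
      using T S A L by (simp_all only: assoc_mult_mat[of _ n n _ n _ n] mult_carrier_mat[of _ n n _ n])
    then show ?thesis unfolding AT inv using S A L by simp
  qed
  then have "right_eigenvalue A l \<longleftrightarrow> right_eigenvalue ?L l" for l
    using right_eigenvalue_similarity[OF A T S L inv(2) AT]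
      right_eigenvalue_similarity[OF L S T A inv(1)] by auto
  \<comment> \<open>All three claims follow from this: the first with \<open>q = l\<close>, the
    second by passing to classes, the third because a left zero is similar to a right zero.\<close>
  then have ev: "right_eigenvalue A l \<longleftrightarrow>
      (\<exists>q. right_zero (companion_poly A B) q \<and> quat_similar l q)" for l
    using right_eigenvalue_companion_mat_iff[OF assms(1)] poly by simp
  have zero: "right_eigenvalue A l" if "right_zero (companion_poly A B) l" for l
    unfolding ev using that quat_similar_refl by blast
  have "right_spectrum A = {similarity_class l | l. right_zero (companion_poly A B) l}"
  proof (intro subset_antisym subsetI)
    fix X assume "X \<in> right_spectrum A"
    then obtain l where l: "X = similarity_class l" "right_eigenvalue A l"
      unfolding right_spectrum_def by blast
    then obtain q where "right_zero (companion_poly A B) q" "quat_similar l q"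
      using ev by blast
    then show "X \<in> {similarity_class l | l. right_zero (companion_poly A B) l}"
      using l(1) similarity_class_eqI by blast
  qed (use zero in \<open>auto simp: right_spectrum_def\<close>)
  moreover have "right_eigenvalue A m" if m: "left_zero (companion_poly A B) m" for m
  proof -
    obtain q where "right_zero (companion_poly A B) q" "quat_similar q m"
      using left_zero_imp_similar_right_zero[OF m] by blast
    then show ?thesis unfolding ev using quat_similar_sym by blast
  qed
  ultimately show ?thesis using zero by blast
qed

end
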